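(* For every $n\geq 0$ and every $P\in\mathcal{D}_n^{h,\geq}$, $$\#UUD(P)=\#UF^+D(\phi(P))+\#UD(\phi(P)).$$
   Context: A Motzkin path of length $n$ is a word in the steps $U=(1,1)$, $D=(1,-1)$, $F=(1,0)$ forming a lattice path from $(0,0)$ to $(n,0)$ never going below the $x$-axis; $\mathcal{M}_n$ is the set of them. A Dyck path of semilength $n$ is a Motzkin path of length $2n$ without $F$ steps. Every nonempty Dyck path has a unique first return decomposition $P=U\alpha D\beta$ with $\alpha,\beta$ Dyck paths; $h$ denotes maximal height. $\mathcal{D}^{h,\geq}$ is defined recursively: it contains the empty path $\epsilon$, and $P=U\alpha D\beta$ belongs to it iff $\alpha,\beta\in\mathcal{D}^{h,\geq}$ and $h(U\alpha D)\geq h(\beta)$; $\mathcal{D}_n^{h,\geq}$ is the subset of semilength $n$. The bijection $\phi:\mathcal{D}_n^{h,\geq}\to\mathcal{M}_n$ is defined by $\phi(\epsilon)=\epsilon$, $\phi(\alpha UD)=\phi(\alpha)F$, $\phi(\alpha UU\beta D\gamma D)=\phi(\alpha)\phi(\gamma)U\phi(\beta)D$. For a word $X$, $\#X(P)$ is the number of occurrences of $X$ as consecutive steps in $P$. For words $Y,Z$ and a step $S$, $\#YS^+Z(P)=\sum_{k\geq 1}\#YS^kZ(P)$, where $S^k$ is $k$ consecutive copies of $S$. *)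

theory Defs
  imports Complex_Main
begin

datatype step = U | D | F

fun rise :: "step \<Rightarrow> int" where
  "rise U = 1"
| "rise D = - 1"
| "rise F = 0"

definition level :: "step list \<Rightarrow> int" where
  "level w = (\<Sum>s\<leftarrow>w. rise s)"

definition is_motzkin :: "step list \<Rightarrow> bool" where
  "is_motzkin w \<longleftrightarrow> level w = 0 \<and> (\<forall>k\<le>length w. 0 \<le> level (take k w))"

definition motzkin :: "nat \<Rightarrow> step list set" where
  "motzkin n = {w. is_motzkin w \<and> length w = n}"

definition is_dyck :: "step list \<Rightarrow> bool" where
  "is_dyck w \<longleftrightarrow> is_motzkin w \<and> F \<notin> set w"

definition dyck :: "nat \<Rightarrow> step list set" where
  "dyck n = {w. is_dyck w \<and> length w = 2 * n}"

definition max_height :: "step list \<Rightarrow> int" where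
  "max_height w = Max ((\<lambda>k. level (take k w)) ` {..length w})"

inductive_set dyck_hge_all :: "step list set" where
  empty: "[] \<in> dyck_hge_all"
| first_return: "\<lbrakk>\<alpha> \<in> dyck_hge_all; \<beta> \<in> dyck_hge_all; max_height (U # \<alpha> @ [D]) \<ge> max_height \<beta>\<rbrakk>
    \<Longrightarrow> U # \<alpha> @ D # \<beta> \<in> dyck_hge_all"

definition dyck_hge :: "nat \<Rightarrow> step list set" where
  "dyck_hge n = {P \<in> dyck_hge_all. length P = 2 * n}"

definition occ :: "step list \<Rightarrow> step list \<Rightarrow> nat" where
  "occ X P = card {i. i + length X \<le> length P \<and> take (length X) (drop i P) = X}"

(* The series has finite support; see occ_plus_finite below. *)
definition occ_plus :: "step list \<Rightarrow> step \<Rightarrow> step list \<Rightarrow> step list \<Rightarrow> nat" where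
  "occ_plus Y S Z P = (\<Sum>k. occ (Y @ replicate (Suc k) S @ Z) P)"

lemma occ_eq_0: "length P < length X \<Longrightarrow> occ X P = 0"
  by (simp add: occ_def)

lemma occ_plus_finite:
  "occ_plus Y S Z P = (\<Sum>k=1..length P. occ (Y @ replicate k S @ Z) P)"
proof -
  have "occ_plus Y S Z P = (\<Sum>k<length P. occ (Y @ replicate (Suc k) S @ Z) P)"
    unfolding occ_plus_def by (rule suminf_finite) (auto intro!: occ_eq_0)
  also have "\<dots> = (\<Sum>k=1..length P. occ (Y @ replicate k S @ Z) P)"
    using sum.atLeast1_atMost_eq[of "\<lambda>k. occ (Y @ replicate k S @ Z) P" "length P"] by simp
  finally show ?thesis .
qed

lemma level_simps [simp]:
  "level [] = 0" "level (s # w) = rise s + level w" "level (v @ w) = level v + level w"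
  by (simp_all add: level_def)

lemma is_dyck_Nil [simp]: "is_dyck []"
  by (simp add: is_dyck_def is_motzkin_def)

lemma is_dyck_level: "is_dyck w \<Longrightarrow> level w = 0"
  by (simp add: is_dyck_def is_motzkin_def)

lemma is_dyck_nonneg: "is_dyck w \<Longrightarrow> 0 \<le> level (take k w)"
  by (cases "k \<le> length w") (auto simp: is_dyck_def is_motzkin_def)

lemma is_dyckI:
  "level w = 0 \<Longrightarrow> (\<And>k. k \<le> length w \<Longrightarrow> 0 \<le> level (take k w)) \<Longrightarrow> F \<notin> set w \<Longrightarrow> is_dyck w"
  by (simp add: is_dyck_def is_motzkin_def)

lemma is_dyck_elevate: "is_dyck \<alpha> \<Longrightarrow> is_dyck (U # \<alpha> @ [D])"
proof (rule is_dyckI)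
  fix k assume a: "is_dyck \<alpha>" "k \<le> length (U # \<alpha> @ [D])"
  show "0 \<le> level (take k (U # \<alpha> @ [D]))"
  proof (cases k)
    case (Suc j)
    have "level (take (j - length \<alpha>) [D]) \<ge> -1" by (cases "j - length \<alpha>") auto
    then show ?thesis using is_dyck_nonneg[OF a(1), of j] Suc by simp
  qed simp
qed (auto simp: is_dyck_level, simp add: is_dyck_def)

lemma is_dyck_append: "is_dyck \<alpha> \<Longrightarrow> is_dyck \<beta> \<Longrightarrow> is_dyck (\<alpha> @ \<beta>)"
proof (rule is_dyckI)
  fix k assume "is_dyck \<alpha>" "is_dyck \<beta>"
  then show "0 \<le> level (take k (\<alpha> @ \<beta>))"
    using is_dyck_nonneg[of \<alpha> k] is_dyck_nonneg[of \<beta> "k - length \<alpha>"] by simp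
qed (auto simp: is_dyck_level, auto simp add: is_dyck_def)

lemma dyck_hge_all_is_dyck: "P \<in> dyck_hge_all \<Longrightarrow> is_dyck P"
proof (induction rule: dyck_hge_all.induct)
  case (first_return \<alpha> \<beta>)
  then show ?case using is_dyck_append[OF is_dyck_elevate[of \<alpha>], of \<beta>] by simp
qed simp

lemma dyck_hge_subset: "dyck_hge n \<subseteq> dyck n"
  by (auto simp: dyck_hge_def dyck_def dyck_hge_all_is_dyck)

lemma first_return_exists:
  assumes "is_dyck P" "P \<noteq> []"
  obtains \<alpha> \<beta> where "is_dyck \<alpha>" "is_dyck \<beta>" "P = U # \<alpha> @ D # \<beta>"
proof -
  have F: "F \<notin> set P" using assms by (simp add: is_dyck_def)
  define k where "k = (LEAST k. 0 < k \<and> level (take k P) = 0)"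
  have ex: "0 < length P \<and> level (take (length P) P) = 0" using assms by (simp add: is_dyck_level)
  have k: "0 < k" "level (take k P) = 0"
    using LeastI[of "\<lambda>k. 0 < k \<and> level (take k P) = 0", OF ex] by (simp_all add: k_def)
  have kl: "k \<le> length P"
    unfolding k_def by (rule Least_le) (rule ex)
  have pos: "0 < level (take j P)" if "0 < j" "j < k" for j
    using not_less_Least[of j "\<lambda>k. 0 < k \<and> level (take k P) = 0"] that
      is_dyck_nonneg[OF assms(1), of j] by (auto simp: k_def)
  obtain s Q where P: "P = s # Q" using assms by (cases P) auto
  have s: "s = U"
    using is_dyck_nonneg[OF assms(1), of 1] F P by (cases s) auto
  obtain j where j: "k = Suc j" using k by (cases k) auto
  have "level (take j Q) = -1" using k j P s by simp
  then obtain i where i: "j = Suc i" by (cases j) auto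
  have il: "i < length Q" using kl j i P by simp
  have tk: "take j Q = take i Q @ [Q ! i]" using il i by (simp add: take_Suc_conv_app_nth)
  have inn: "0 \<le> level (take m Q)" if "m \<le> i" for m
    using pos[of "Suc m"] that j i P s by simp
  have Qi: "Q ! i = D" and li: "level (take i Q) = 0"
  proof -
    have "Q ! i \<noteq> F" using F P il by (metis list.set_intros(2) nth_mem)
    moreover have "level (take i Q) + rise (Q ! i) = -1" using \<open>level (take j Q) = -1\<close> tk by simp
    ultimately show "Q ! i = D" "level (take i Q) = 0" using inn[of i] by (cases "Q ! i"; simp)+
  qed
  have Pe: "P = U # take i Q @ D # drop (Suc i) Q"
    using id_take_nth_drop[OF il] Qi P s by simp
  have a: "is_dyck (take i Q)"
  proof (rule is_dyckI)
    show "F \<notin> set (take i Q)" using F P by (auto dest: in_set_takeD)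
  qed (use li inn in \<open>auto simp: min_def\<close>)
  have b: "is_dyck (drop (Suc i) Q)"
  proof (rule is_dyckI)
    have "level P = 0" using assms by (simp add: is_dyck_level)
    then show "level (drop (Suc i) Q) = 0" using li by (subst (asm) Pe) simp
    show "F \<notin> set (drop (Suc i) Q)" using F P by (auto dest: in_set_dropD)
    fix m
    have "0 \<le> level (take (Suc (Suc i) + m) P)" by (rule is_dyck_nonneg[OF assms(1)])
    then show "0 \<le> level (take m (drop (Suc i) Q))"
      using li il by (subst (asm) Pe) (simp add: min_def)
  qed
  show thesis using that[OF a b Pe] .
qed

lemma first_return_unique:
  assumes "is_dyck \<beta>" "is_dyck \<beta>'" "\<beta> @ D # \<gamma> = \<beta>' @ D # \<gamma>'"
  shows "\<beta> = \<beta>' \<and> \<gamma> = \<gamma>'"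
proof -
  have *: False if "is_dyck b" "is_dyck b'" "b @ D # c = b' @ D # c'" "length b < length b'" for b b' c c'
  proof -
    have "take (Suc (length b)) (b @ D # c) = take (Suc (length b)) (b' @ D # c')"
      by (simp only: that)
    then have "level (b @ [D]) = level (take (Suc (length b)) b')" using that(4) by simp
    then show False using is_dyck_nonneg[OF that(2), of "Suc (length b)"] that(1)
      by (simp add: is_dyck_level)
  qed
  have "length \<beta> = length \<beta>'"
  proof (rule linorder_cases)
  qed (use *[OF assms] *[OF assms(2,1) assms(3)[symmetric]] in auto)
  then show ?thesis using assms(3) by simp
qed

lemma last_return_exists:
  assumes "is_dyck P" "P \<noteq> []"
  obtains \<alpha> \<delta> where "is_dyck \<alpha>" "is_dyck \<delta>" "P = \<alpha> @ U # \<delta> @ [D]"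
  using assms
proof (induction "length P" arbitrary: P thesis rule: less_induct)
  case less
  obtain a b where ab: "is_dyck a" "is_dyck b" "P = U # a @ D # b"
    using first_return_exists[OF less.prems(2,3)] .
  show ?case
  proof (cases "b = []")
    case True
    then show ?thesis using less.prems(1)[of "[]" a] ab by simp
  next
    case False
    obtain \<alpha> \<delta> where *: "is_dyck \<alpha>" "is_dyck \<delta>" "b = \<alpha> @ U # \<delta> @ [D]"
      by (rule less.hyps[of b]) (use ab False in auto)
    show ?thesis
      using less.prems(1)[of "(U # a @ [D]) @ \<alpha>" \<delta>] * ab is_dyck_append[OF is_dyck_elevate]
      by simp
  qed
qed

lemma last_return_unique:
  assumes "is_dyck \<alpha>" "is_dyck \<alpha>'" "is_dyck \<delta>" "is_dyck \<delta>'" "\<alpha> @ U # \<delta> @ [D] = \<alpha>' @ U # \<delta>' @ [D]"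
  shows "\<alpha> = \<alpha>' \<and> \<delta> = \<delta>'"
proof -
  have *: False if "is_dyck a" "is_dyck a'" "is_dyck d" "a @ U # d @ [D] = a' @ U # d' @ [D]"
      "length a < length a'" for a a' d d'
  proof -
    obtain j where j: "length a' = Suc (length a + j)"
      using less_imp_Suc_add[OF \<open>length a < length a'\<close>] by auto
    have "length (a @ U # d @ [D]) = length (a' @ U # d' @ [D])" by (simp only: that)
    then have jd: "j \<le> length d" using j by simp
    have "take (length a') (a @ U # d @ [D]) = take (length a') (a' @ U # d' @ [D])"
      by (simp only: that)
    then have "level (a @ U # take j d) = level a'" using j jd by simp
    then show False using that is_dyck_nonneg[OF that(3), of j] by (simp add: is_dyck_level)
  qed
  have "length \<alpha> = length \<alpha>'"
  proof (rule linorder_cases)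
  qed (use *[OF assms(1,2,3,5)] *[OF assms(2,1,4) assms(5)[symmetric]] in auto)
  then show ?thesis using assms(5) by simp
qed

(* The recursion makes sense on all Dyck paths; the bijection onto Motzkin paths is its
   restriction to dyck_hge n.  The last equation is a dummy value off Dyck paths. *)
function phi :: "step list \<Rightarrow> step list" where
  "phi [] = []"
| "is_dyck \<alpha> \<Longrightarrow> phi (\<alpha> @ [U, D]) = phi \<alpha> @ [F]"
| "is_dyck \<alpha> \<Longrightarrow> is_dyck \<beta> \<Longrightarrow> is_dyck \<gamma> \<Longrightarrow>
     phi (\<alpha> @ [U, U] @ \<beta> @ [D] @ \<gamma> @ [D]) = phi \<alpha> @ phi \<gamma> @ [U] @ phi \<beta> @ [D]"
| "\<not> is_dyck P \<Longrightarrow> phi P = []"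
proof -
  have dyck2: "is_dyck (\<alpha> @ [U, D])" if "is_dyck \<alpha>" for \<alpha>
    using is_dyck_append[OF that is_dyck_elevate[of "[]"]] by simp
  have dyckd: "is_dyck (U # \<beta> @ D # \<gamma>)" if "is_dyck \<beta>" "is_dyck \<gamma>" for \<beta> \<gamma>
    using is_dyck_append[OF is_dyck_elevate[OF that(1)] that(2)] by simp
  have dyck3: "is_dyck (\<alpha> @ U # U # \<beta> @ D # \<gamma> @ [D])" if "is_dyck \<alpha>" "is_dyck \<beta>" "is_dyck \<gamma>" for \<alpha> \<beta> \<gamma>
    using is_dyck_append[OF that(1) is_dyck_elevate[OF dyckd[OF that(2,3)]]] by simp
  {
    fix Q :: bool and x
    assume c: "x = [] \<Longrightarrow> Q"
      "\<And>\<alpha>. is_dyck \<alpha> \<Longrightarrow> x = \<alpha> @ [U, D] \<Longrightarrow> Q"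
      "\<And>\<alpha> \<beta> \<gamma>. is_dyck \<alpha> \<Longrightarrow> is_dyck \<beta> \<Longrightarrow> is_dyck \<gamma> \<Longrightarrow>
         x = \<alpha> @ [U, U] @ \<beta> @ [D] @ \<gamma> @ [D] \<Longrightarrow> Q"
      "\<And>P. \<not> is_dyck P \<Longrightarrow> x = P \<Longrightarrow> Q"
    show Q
    proof (cases "is_dyck x \<and> x \<noteq> []")
      case True
      then obtain \<alpha> \<delta> where *: "is_dyck \<alpha>" "is_dyck \<delta>" "x = \<alpha> @ U # \<delta> @ [D]"
        using last_return_exists by metis
      show Q
      proof (cases "\<delta> = []")
        case True then show Q using c(2)[of \<alpha>] * by simp
      next
        case False
        then obtain \<beta> \<gamma> where "is_dyck \<beta>" "is_dyck \<gamma>" "\<delta> = U # \<beta> @ D # \<gamma>"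
          using first_return_exists[OF *(2)] by metis
        then show Q using c(3)[of \<alpha> \<beta> \<gamma>] * by simp
      qed
    qed (use c(1,4) in auto)
  next
    fix \<alpha> \<alpha>' assume "is_dyck \<alpha>" "is_dyck \<alpha>'" "\<alpha> @ [U, D] = \<alpha>' @ [U, D]"
    then show "phi_sumC \<alpha> @ [F] = phi_sumC \<alpha>' @ [F]" by simp
  next
    fix \<alpha> \<alpha>' \<beta> \<gamma>
    assume "is_dyck \<alpha>" "is_dyck \<alpha>'" "is_dyck \<beta>" "is_dyck \<gamma>"
      "\<alpha> @ [U, D] = \<alpha>' @ [U, U] @ \<beta> @ [D] @ \<gamma> @ [D]"
    then have False using last_return_unique[of \<alpha> \<alpha>' "[]" "U # \<beta> @ D # \<gamma>"] dyckd by simp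
    then show "phi_sumC \<alpha> @ [F] = phi_sumC \<alpha>' @ phi_sumC \<gamma> @ [U] @ phi_sumC \<beta> @ [D]" ..
  next
    fix \<alpha> P assume "is_dyck \<alpha>" "\<not> is_dyck P" "\<alpha> @ [U, D] = P"
    then show "phi_sumC \<alpha> @ [F] = []" using dyck2 by auto
  next
    fix \<alpha> \<beta> \<gamma> \<alpha>' \<beta>' \<gamma>'
    assume a: "is_dyck \<alpha>" "is_dyck \<alpha>'" "is_dyck \<beta>" "is_dyck \<gamma>" "is_dyck \<beta>'" "is_dyck \<gamma>'"
      "\<alpha> @ [U, U] @ \<beta> @ [D] @ \<gamma> @ [D] = \<alpha>' @ [U, U] @ \<beta>' @ [D] @ \<gamma>' @ [D]"
    have "\<alpha> = \<alpha>' \<and> U # \<beta> @ D # \<gamma> = U # \<beta>' @ D # \<gamma>'"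
      by (rule last_return_unique) (use a dyckd in simp_all)
    then have "\<alpha> = \<alpha>' \<and> \<beta> = \<beta>' \<and> \<gamma> = \<gamma>'"
      using first_return_unique[OF a(3,5), of \<gamma> \<gamma>'] by simp
    then show "phi_sumC \<alpha> @ phi_sumC \<gamma> @ [U] @ phi_sumC \<beta> @ [D] =
        phi_sumC \<alpha>' @ phi_sumC \<gamma>' @ [U] @ phi_sumC \<beta>' @ [D]" by simp
  next
    fix \<alpha> \<beta> \<gamma> P
    assume "is_dyck \<alpha>" "is_dyck \<beta>" "is_dyck \<gamma>" "\<not> is_dyck P"
      "\<alpha> @ [U, U] @ \<beta> @ [D] @ \<gamma> @ [D] = P"
    then show "phi_sumC \<alpha> @ phi_sumC \<gamma> @ [U] @ phi_sumC \<beta> @ [D] = []"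
      using dyck3 by auto
  }
qed auto
termination by (relation "measure length") auto

lemma is_motzkin_elevate_append:
  assumes "is_motzkin v" "is_motzkin w"
  shows "is_motzkin (v @ U # w @ [D])"
  unfolding is_motzkin_def
proof (intro conjI allI impI)
  show "level (v @ U # w @ [D]) = 0" using assms by (simp add: is_motzkin_def)
  fix k
  have nn: "0 \<le> level (take j x)" if "is_motzkin x" for j x
    using that by (cases "j \<le> length x") (auto simp: is_motzkin_def)
  show "0 \<le> level (take k (v @ U # w @ [D]))"
  proof (cases "k \<le> length v")
    case True then show ?thesis using nn[OF assms(1), of k] by simp
  next
    case False
    then obtain j where j: "k = Suc (length v + j)" using less_imp_Suc_add[of "length v" k] by auto
    have "level (take (j - length w) [D]) \<ge> -1" by (cases "j - length w") auto
    then show ?thesis using nn[OF assms(2), of j] assms(1) j by (simp add: is_motzkin_def)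
  qed
qed

lemma is_motzkin_append:
  assumes "is_motzkin v" "is_motzkin w"
  shows "is_motzkin (v @ w)"
  unfolding is_motzkin_def
proof (intro conjI allI impI)
  show "level (v @ w) = 0" using assms by (simp add: is_motzkin_def)
  fix k assume "k \<le> length (v @ w)"
  then show "0 \<le> level (take k (v @ w))"
    using assms by (cases "k \<le> length v") (auto simp: is_motzkin_def)
qed

lemma phi_motzkin:
  assumes "P \<in> dyck n"
  shows "phi P \<in> motzkin n"
proof -
  have "is_motzkin (phi P) \<and> 2 * length (phi P) = length P" if "is_dyck P" for P
    using that
  proof (induction P rule: phi.induct)
    case (2 \<alpha>)
    have "is_motzkin [F]" by (auto simp: is_motzkin_def le_Suc_eq)
    then show ?case using 2 is_motzkin_append[of "phi \<alpha>" "[F]"] by simp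
  next
    case (3 \<alpha> \<beta> \<gamma>)
    then show ?case
      using is_motzkin_elevate_append[OF is_motzkin_append[of "phi \<alpha>" "phi \<gamma>"], of "phi \<beta>"]
        phi.simps(3)[of \<alpha> \<beta> \<gamma>] by simp
  qed (auto simp: is_motzkin_def)
  from this[of P] show ?thesis using assms by (auto simp: dyck_def motzkin_def)
qed

end

(* Write P = \<alpha> U U \<beta> D \<gamma> D, so that phi P = phi \<alpha> phi \<gamma> U phi \<beta> D.  Besides the occurrences inside the
   three factors, UUD occurs once more in P iff \<beta> is empty or starts with UD, and a factor U F^k D
   (k \<ge> 0) occurs once more in phi P iff phi \<beta> consists of F steps only.  For \<beta> in the class both
   conditions say that \<beta> has height at most 1, hence the claim follows by induction along phi. *)
theory Submission
  imports Defs
begin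

section \<open>Occurrences of a fixed factor\<close>

lemma occ_Nil: "X \<noteq> [] \<Longrightarrow> occ X [] = 0"
  by (simp add: occ_eq_0)

lemma occ_Cons:
  assumes "X \<noteq> []"
  shows "occ X (s # w) = occ X w + of_bool (take (length X) (s # w) = X)"
proof -
  let ?O = "\<lambda>w. {i. i + length X \<le> length w \<and> take (length X) (drop i w) = X}"
  let ?B = "{i. i = (0::nat) \<and> take (length X) (s # w) = X}"
  have "i \<in> ?O (s # w) \<longleftrightarrow> i \<in> Suc ` ?O w \<union> ?B" for i
  proof (cases i)
    case 0
    \<comment> \<open>Equality of the prefix with \<open>X\<close> already forces the length bound,
      so the possible occurrence at position 0 needs no separate bound.\<close>
    have "length X \<le> length (s # w)" if "take (length X) (s # w) = X"
      using arg_cong[OF that, of length] by simp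
    then show ?thesis using 0 by auto
  qed auto
  then have "?O (s # w) = Suc ` ?O w \<union> ?B" by blast
  moreover have "finite (?O w)" by (rule finite_subset[of _ "{..length w}"]) auto
  moreover have "card ?B = of_bool (take (length X) (s # w) = X)" by simp
  ultimately show ?thesis
    unfolding occ_def by (simp add: card_Un_disjoint card_image disjoint_iff)
qed

lemma occ_UUD_Cons:
  "occ [U, U, D] (s # w) = occ [U, U, D] w + of_bool (s = U \<and> take 2 w = [U, D])"
  by (simp add: occ_Cons numeral_2_eq_2)

text \<open>An occurrence straddling the cut would have \<open>U\<close> as its last letter before
  the cut, since \<open>D\<close> comes only at the end of \<open>UUD\<close>.\<close>

lemma occ_UUD_append:
  "v = [] \<or> last v = D \<Longrightarrow> occ [U, U, D] (v @ x) = occ [U, U, D] v + occ [U, U, D] x"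
proof (induction v)
  case (Cons s v)
  have "take 2 (v @ x) = [U, D] \<longleftrightarrow> take 2 v = [U, D]" if U: "s = U"
  proof -
    obtain t v' where "v = t # v'" "last v = D" using Cons.prems U by (cases v) auto
    then show ?thesis by (cases v') (auto simp: numeral_2_eq_2)
  qed
  then show ?case using Cons by (auto simp: occ_UUD_Cons split: if_splits)
qed (simp add: occ_Nil)

section \<open>Flat peaks and concatenation\<close>

text \<open>\<open>occ_plus\<close> starts at exponent 1; the peaks \<open>UD\<close> supply
  exponent 0, so that all factors U F^k D with k \<ge> 0 are treated uniformly.\<close>

definition flat_peaks :: "step list \<Rightarrow> nat" where
  "flat_peaks w = occ_plus [U] F [D] w + occ [U, D] w"

text \<open>This is the condition on \<open>w\<close> under which a \<open>U\<close> put in front of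
  it opens a flat peak.\<close>

definition starts_flat_D :: "step list \<Rightarrow> bool" where
  "starts_flat_D w \<longleftrightarrow> (\<exists>k v. w = replicate k F @ D # v)"

lemma starts_flat_D_Nil: "\<not> starts_flat_D []"
  by (simp add: starts_flat_D_def)

lemma starts_flat_D_Cons:
  "starts_flat_D (s # w) \<longleftrightarrow> s = D \<or> s = F \<and> starts_flat_D w"
proof
  assume "starts_flat_D (s # w)"
  then obtain k v where "s # w = replicate k F @ D # v" by (auto simp: starts_flat_D_def)
  then show "s = D \<or> s = F \<and> starts_flat_D w"
    by (cases k) (auto simp: starts_flat_D_def)
next
  assume "s = D \<or> s = F \<and> starts_flat_D w"
  then show "starts_flat_D (s # w)"
    unfolding starts_flat_D_def
    by (metis append_Cons append_Nil replicate_0 replicate_Suc)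
qed

lemma starts_flat_D_append:
  "starts_flat_D (v @ x) \<longleftrightarrow> starts_flat_D v \<or> set v \<subseteq> {F} \<and> starts_flat_D x"
  by (induction v) (auto simp: starts_flat_D_Nil starts_flat_D_Cons)

lemma level_replicate_F: "level (replicate k F) = 0"
  by (induction k) auto

lemma motzkin_nonneg: "is_motzkin w \<Longrightarrow> 0 \<le> level (take k w)"
  by (cases "k \<le> length w") (auto simp: is_motzkin_def)

text \<open>The first \<open>D\<close> after a run of flat steps would lead to level -1.\<close>

lemma motzkin_not_starts_flat_D:
  assumes "is_motzkin w"
  shows "\<not> starts_flat_D w"
proof
  assume "starts_flat_D w"
  then obtain k v where w: "w = replicate k F @ D # v" by (auto simp: starts_flat_D_def)
  have "0 \<le> level (take (Suc k) w)" using assms by (rule motzkin_nonneg)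
  then show False by (simp add: w level_replicate_F)
qed

text \<open>The bound \<open>N\<close> is left free so that a word and its tail can be summed over
  the same range of exponents.\<close>

lemma flat_peaks_sum:
  assumes "length w \<le> N"
  shows "flat_peaks w = (\<Sum>k\<le>N. occ (U # replicate k F @ [D]) w)"
proof -
  have "occ_plus [U] F [D] w = (\<Sum>k<N. occ (U # replicate (Suc k) F @ [D]) w)"
    unfolding occ_plus_def append_Cons append_Nil
    by (rule suminf_finite) (use assms in \<open>auto intro!: occ_eq_0\<close>)
  then show ?thesis
    by (simp add: flat_peaks_def sum.atMost_shift)
qed

lemma flat_peaks_Nil: "flat_peaks [] = 0"
  by (simp add: flat_peaks_sum[of "[]" 0] occ_Nil)

text \<open>A leading \<open>U\<close> opens at most one flat peak, because the exponent k is
  determined by the word that follows.\<close>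

lemma flat_peaks_Cons:
  "flat_peaks (s # w) = flat_peaks w + of_bool (s = U \<and> starts_flat_D w)"
proof -
  let ?N = "Suc (length w)"
  let ?p = "\<lambda>k. take (Suc k) w = replicate k F @ [D]"
  have "flat_peaks (s # w)
      = (\<Sum>k\<le>?N. occ (U # replicate k F @ [D]) w + of_bool (s = U \<and> ?p k))"
    by (simp add: flat_peaks_sum[of _ ?N] occ_Cons)
  also have "\<dots> = flat_peaks w + (\<Sum>k\<le>?N. of_bool (s = U \<and> ?p k))"
    by (simp add: sum.distrib flat_peaks_sum[of w ?N])
  also have "(\<Sum>k\<le>?N. of_bool (s = U \<and> ?p k)) = (of_bool (s = U \<and> starts_flat_D w) :: nat)"
  proof (cases "s = U \<and> starts_flat_D w")
    case True
    then obtain k v where w: "w = replicate k F @ D # v" by (auto simp: starts_flat_D_def)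
    have "?p j \<longleftrightarrow> j = k" for j
    proof
      assume p: "?p j"
      have j: "w = replicate j F @ D # drop (Suc j) w"
        using append_take_drop_id[of "Suc j" w] p by simp
      \<comment> \<open>The exponent is the length of the initial run of \<open>F\<close>, hence
        unique.\<close>
      have "length (takeWhile (\<lambda>t. t = F) (replicate i F @ D # x)) = i" for i x
        by (induction i) auto
      then show "j = k" using j w by metis
    qed (simp add: w)
    moreover have "k \<le> ?N" by (simp add: w)
    ultimately show ?thesis using True by (simp add: of_bool_def)
  next
    case False
    have "starts_flat_D w" if "?p k" for k
      using append_take_drop_id[of "Suc k" w] that unfolding starts_flat_D_def
      by (metis append_assoc append_Cons append_Nil)
    then have "(of_bool (s = U \<and> ?p k) :: nat) = 0" for k
      using False by auto
    then show ?thesis using False by (simp only: sum.neutral_const of_bool_eq if_False)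
  qed
  finally show ?thesis .
qed

text \<open>A flat peak across the cut has its \<open>U\<close> in \<open>v\<close> and leaves some
  F^j D at the start of \<open>x\<close>.\<close>

lemma flat_peaks_append:
  "\<not> starts_flat_D x \<Longrightarrow> flat_peaks (v @ x) = flat_peaks v + flat_peaks x"
  by (induction v) (simp_all add: flat_peaks_Nil flat_peaks_Cons starts_flat_D_append)

text \<open>A new flat peak must end in the appended \<open>D\<close>, so \<open>w\<close> would
  have to end in U F^k.\<close>

lemma flat_peaks_snoc_D:
  "(\<And>a k. w \<noteq> a @ U # replicate k F) \<Longrightarrow> flat_peaks (w @ [D]) = flat_peaks w"
proof (induction w)
  case Nil
  show ?case by (simp add: flat_peaks_Nil flat_peaks_Cons)
next
  case (Cons s w)
  have "w \<noteq> a @ U # replicate k F" for a k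
    using Cons.prems[of "s # a" k] by simp
  moreover have "\<not> set w \<subseteq> {F}" if "s = U"
  proof
    assume "set w \<subseteq> {F}"
    then have "w = replicate (length w) F" by (intro replicate_eqI) auto
    then show False using Cons.prems[of "[]" "length w"] that by simp
  qed
  ultimately show ?case using Cons.IH
    by (auto simp: flat_peaks_Cons starts_flat_D_append)
qed

text \<open>If a path ending at level 0 ended in U F^k, it would be at level -1 before that
  \<open>U\<close>.\<close>

lemma flat_peaks_motzkin_snoc_D:
  assumes "is_motzkin w"
  shows "flat_peaks (w @ [D]) = flat_peaks w"
proof (rule flat_peaks_snoc_D)
  fix a k
  show "w \<noteq> a @ U # replicate k F"
  proof
    assume w: "w = a @ U # replicate k F"
    then have "level a = -1" using assms by (simp add: is_motzkin_def level_replicate_F)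
    moreover have "0 \<le> level (take (length a) w)" using assms by (rule motzkin_nonneg)
    ultimately show False by (simp add: w)
  qed
qed

section \<open>Height and flat images\<close>

text \<open>Prefixes longer than the word are the word itself, so k may range over all naturals and
  later arguments avoid a length condition.\<close>

lemma max_height_le_iff: "max_height w \<le> c \<longleftrightarrow> (\<forall>k. level (take k w) \<le> c)"
proof -
  have "max_height w \<le> c \<longleftrightarrow> (\<forall>k\<le>length w. level (take k w) \<le> c)"
    by (auto simp: max_height_def)
  also have "\<dots> \<longleftrightarrow> (\<forall>k. level (take k w) \<le> c)"
    by (metis nle_le take_all)
  finally show ?thesis .
qed

lemma level_take_le_max_height: "level (take k w) \<le> max_height w"
  using max_height_le_iff by blast

lemma max_height_append_le: "max_height v \<le> max_height (v @ w)"
  unfolding max_height_le_iff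
proof
  fix k
  show "level (take k v) \<le> max_height (v @ w)"
    using level_take_le_max_height[of k "v @ w"] level_take_le_max_height[of "length v" "v @ w"]
    by (cases "k \<le> length v") auto
qed

lemma is_motzkin_phi: "is_dyck P \<Longrightarrow> is_motzkin (phi P)"
proof -
  assume P: "is_dyck P"
  \<comment> \<open>\<open>phi_motzkin\<close> speaks of a given semilength, which exists once the
    length is even.\<close>
  have "even (length P)" if "is_dyck P" for P
    using that
  proof (induction P rule: phi.induct)
  qed auto
  then show ?thesis using P phi_motzkin[of P "length P div 2"] by (auto simp: dyck_def motzkin_def)
qed

lemma dyck_last: "is_dyck P \<Longrightarrow> P = [] \<or> last P = D"
  using last_return_exists[of P] by force

lemma dyck_hd: "is_dyck P \<Longrightarrow> P = [] \<or> hd P = U"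
  using first_return_exists[of P] by force

text \<open>Appending \<open>UD\<close> to a Dyck path adds a flat step to the image and only
  touches level 1, whereas the other recursion case adds a \<open>U\<close> to the image and has a
  prefix at level 2. No height condition of the class is involved.\<close>

lemma phi_flat_iff:
  "is_dyck P \<Longrightarrow> set (phi P) \<subseteq> {F} \<longleftrightarrow> max_height P \<le> 1"
proof (induction P rule: phi.induct)
  case 1
  show ?case by (simp add: max_height_def)
next
  case (2 \<alpha>)
  \<comment> \<open>Past \<open>\<alpha>\<close>, which ends at level 0, the levels are 0, 1, 0; the
    two case splits separate these offsets.\<close>
  have "level (take k (\<alpha> @ [U, D])) \<le> 1" if "max_height \<alpha> \<le> 1" for k
    using that is_dyck_level[OF 2(1)]
    by (cases "k - length \<alpha>"; cases "k - length \<alpha> - 1") (auto simp: max_height_le_iff)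
  then have "max_height \<alpha> \<le> 1 \<Longrightarrow> max_height (\<alpha> @ [U, D]) \<le> 1"
    unfolding max_height_le_iff[of "\<alpha> @ [U, D]"] by blast
  then have "max_height (\<alpha> @ [U, D]) \<le> 1 \<longleftrightarrow> max_height \<alpha> \<le> 1"
    using max_height_append_le[of \<alpha> "[U, D]"] by linarith
  then show ?case using 2 by simp
next
  case (3 \<alpha> \<beta> \<gamma>)
  have "level (take (length \<alpha> + 2) (\<alpha> @ [U, U] @ \<beta> @ [D] @ \<gamma> @ [D])) = 2"
    using is_dyck_level[OF 3(1)] by simp
  then have "\<not> max_height (\<alpha> @ [U, U] @ \<beta> @ [D] @ \<gamma> @ [D]) \<le> 1"
    using level_take_le_max_height[of "length \<alpha> + 2" "\<alpha> @ [U, U] @ \<beta> @ [D] @ \<gamma> @ [D]"] by linarith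
  then show ?case using 3 phi.simps(3)[OF 3(1-3)] by simp
qed simp

section \<open>Decomposing paths of the class\<close>

text \<open>Inversion of the introduction rule: as \<open>\<alpha>\<close> is Dyck, the displayed
  \<open>D\<close> is the first return, and uniqueness identifies the factors.\<close>

lemma dyck_hge_all_first_return:
  assumes "U # \<alpha> @ D # \<beta> \<in> dyck_hge_all" "is_dyck \<alpha>"
  shows "\<alpha> \<in> dyck_hge_all \<and> \<beta> \<in> dyck_hge_all \<and> max_height \<beta> \<le> max_height (U # \<alpha> @ [D])"
  using assms(1)
proof (cases rule: dyck_hge_all.cases)
  case (first_return \<alpha>' \<beta>')
  then have "\<alpha> = \<alpha>' \<and> \<beta> = \<beta>'"
    using first_return_unique[OF assms(2) dyck_hge_all_is_dyck[of \<alpha>'], of \<beta> \<beta>'] by simp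
  then show ?thesis using first_return by auto
qed

text \<open>The class is built from first returns but \<open>phi\<close> recurses on the last one;
  this connects the two. First-return blocks are peeled off \<open>\<alpha>\<close>, and the height
  condition survives because cutting off a suffix cannot raise the maximal height.\<close>

lemma dyck_hge_all_last_return:
  assumes "\<alpha> @ U # \<delta> @ [D] \<in> dyck_hge_all" "is_dyck \<alpha>" "is_dyck \<delta>"
  shows "\<alpha> \<in> dyck_hge_all \<and> \<delta> \<in> dyck_hge_all"
  using assms
proof (induction "length \<alpha>" arbitrary: \<alpha> rule: less_induct)
  case less
  show ?case
  proof (cases "\<alpha> = []")
    case True
    then show ?thesis
      using dyck_hge_all_first_return[of \<delta> "[]"] less.prems dyck_hge_all.empty by simp
  next
    case False
    then obtain a b where ab: "is_dyck a" "is_dyck b" "\<alpha> = U # a @ D # b"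
      using first_return_exists[OF less.prems(2)] by metis
    let ?c = "b @ U # \<delta> @ [D]"
    have *: "a \<in> dyck_hge_all" "?c \<in> dyck_hge_all" "max_height ?c \<le> max_height (U # a @ [D])"
      using dyck_hge_all_first_return[of a ?c] less.prems(1) ab by simp_all
    have "b \<in> dyck_hge_all \<and> \<delta> \<in> dyck_hge_all"
      using less.hyps[of b] ab * less.prems(3) by simp
    moreover have "max_height b \<le> max_height (U # a @ [D])"
      using *(3) max_height_append_le[of b "U # \<delta> @ [D]"] by simp
    ultimately show ?thesis using dyck_hge_all.first_return[OF *(1)] ab by simp
  qed
qed

text \<open>The only place where the height condition of the class matters.\<close>

lemma dyck_hge_all_height_le_1_iff:
  assumes "P \<in> dyck_hge_all"
  shows "max_height P \<le> 1 \<longleftrightarrow> P = [] \<or> take 2 P = [U, D]"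
  using assms
proof (cases rule: dyck_hge_all.cases)
  case empty
  then show ?thesis by (simp add: max_height_def)
next
  case (first_return \<alpha> \<beta>)
  show ?thesis
  proof (cases "\<alpha> = []")
    case True
    \<comment> \<open>With \<open>\<alpha>\<close> empty, the height condition bounds
      \<open>\<beta>\<close> by the height of \<open>UD\<close>.\<close>
    have "max_height [U, D] = 1" by (simp add: max_height_def atMost_Suc)
    then have "level (take k \<beta>) \<le> 1" for k
      using first_return True level_take_le_max_height[of k \<beta>] by simp
    then have "level (take k P) \<le> 1" for k
      using first_return True by (cases k; cases "k - 1") auto
    then show ?thesis using first_return True by (simp add: max_height_le_iff numeral_2_eq_2)
  next
    case False
    \<comment> \<open>A nonempty \<open>\<alpha>\<close> starts with \<open>U\<close>, so
      \<open>P\<close> starts with \<open>UU\<close> and reaches level 2.\<close>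
    then obtain \<alpha>' where "\<alpha> = U # \<alpha>'"
      using dyck_hd[OF dyck_hge_all_is_dyck[of \<alpha>]] first_return by (cases \<alpha>) auto
    then have "level (take 2 P) = 2" "take 2 P \<noteq> [U, D]" "P \<noteq> []"
      using first_return by (auto simp: numeral_2_eq_2)
    then show ?thesis using level_take_le_max_height[of 2 P] by auto
  qed
qed

section \<open>The induction along \<open>phi\<close>\<close>

lemma occ_UUD_eq_flat_peaks_phi:
  "P \<in> dyck_hge_all \<Longrightarrow> occ [U, U, D] P = flat_peaks (phi P)"
proof (induction P rule: phi.induct)
  case 1
  show ?case by (simp add: occ_Nil flat_peaks_Nil)
next
  case (2 \<alpha>)
  have "\<alpha> \<in> dyck_hge_all" using dyck_hge_all_last_return[of \<alpha> "[]"] 2 by simp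
  then have "occ [U, U, D] \<alpha> = flat_peaks (phi \<alpha>)" by (rule 2(2))
  moreover have "occ [U, U, D] (\<alpha> @ [U, D]) = occ [U, U, D] \<alpha>"
    by (simp add: occ_UUD_append[OF dyck_last[OF 2(1)]] occ_UUD_Cons occ_Nil)
  moreover have "flat_peaks (phi \<alpha> @ [F]) = flat_peaks (phi \<alpha>)"
    using flat_peaks_append[of "[F]" "phi \<alpha>"]
    by (simp add: starts_flat_D_Cons starts_flat_D_Nil flat_peaks_Cons flat_peaks_Nil)
  ultimately show ?case using 2(1) by simp
next
  case (3 \<alpha> \<beta> \<gamma>)
  have "is_dyck (U # \<beta> @ D # \<gamma>)"
    using is_dyck_append[OF is_dyck_elevate[OF 3(2)] 3(3)] by simp
  then have "\<alpha> \<in> dyck_hge_all \<and> U # \<beta> @ D # \<gamma> \<in> dyck_hge_all"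
    using dyck_hge_all_last_return[of \<alpha> "U # \<beta> @ D # \<gamma>"] 3 by simp
  then have hge: "\<alpha> \<in> dyck_hge_all" "\<beta> \<in> dyck_hge_all" "\<gamma> \<in> dyck_hge_all"
    using dyck_hge_all_first_return[of \<beta> \<gamma>] 3(2) by simp_all
  let ?low = "\<beta> = [] \<or> take 2 \<beta> = [U, D]"
  let ?y = "D # \<gamma> @ [D]"
  have y: "occ [U, U, D] ?y = occ [U, U, D] \<gamma>"
    by (simp add: occ_UUD_Cons occ_UUD_append[OF dyck_last[OF 3(3)]] occ_Nil)
  \<comment> \<open>The first new \<open>U\<close> begins an occurrence iff \<open>\<beta>\<close>
    is empty, the second iff \<open>\<beta>\<close> starts with \<open>UD\<close>. These cases
    exclude each other, so the indicators add up to one indicator.\<close>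
  have low: "of_bool (take 2 (U # \<beta> @ ?y) = [U, D]) + of_bool (take 2 (\<beta> @ ?y) = [U, D])
      = (of_bool ?low :: nat)"
  proof (cases \<beta>)
    case (Cons s b)
    then have "s = U" "b \<noteq> []" using dyck_hd[OF 3(2)] dyck_last[OF 3(2)] by auto
    then show ?thesis using Cons by (cases b) (auto simp: numeral_2_eq_2)
  qed (simp add: numeral_2_eq_2)
  have "occ [U, U, D] (\<alpha> @ [U, U] @ \<beta> @ [D] @ \<gamma> @ [D])
      = occ [U, U, D] \<alpha> + occ [U, U, D] (U # U # \<beta> @ ?y)"
    by (simp add: occ_UUD_append[OF dyck_last[OF 3(1)]])
  also have "occ [U, U, D] (U # U # \<beta> @ ?y) = occ [U, U, D] (\<beta> @ ?y) + of_bool ?low"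
    using low by (simp add: occ_UUD_Cons)
  also have "occ [U, U, D] (\<beta> @ ?y) = occ [U, U, D] \<beta> + occ [U, U, D] \<gamma>"
    by (simp only: occ_UUD_append[OF dyck_last[OF 3(2)]] y)
  finally have lhs: "occ [U, U, D] (\<alpha> @ [U, U] @ \<beta> @ [D] @ \<gamma> @ [D])
      = occ [U, U, D] \<alpha> + (occ [U, U, D] \<beta> + occ [U, U, D] \<gamma> + of_bool ?low)" .
  note m = 3(1-3)[THEN is_motzkin_phi]
  let ?z = "U # phi \<beta> @ [D]"
  \<comment> \<open>The closing \<open>D\<close> completes no flat peak begun inside the Motzkin
    path \<open>phi \<beta>\<close>; only the new \<open>U\<close> can match it, across flat steps
    alone.\<close>
  have "flat_peaks ?z = flat_peaks (phi \<beta>) + of_bool (set (phi \<beta>) \<subseteq> {F})"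
    using motzkin_not_starts_flat_D[OF m(2)]
    by (simp add: flat_peaks_Cons flat_peaks_motzkin_snoc_D[OF m(2)] starts_flat_D_append
        starts_flat_D_Cons)
  moreover have "flat_peaks (phi \<alpha> @ phi \<gamma> @ ?z)
      = flat_peaks (phi \<alpha>) + (flat_peaks (phi \<gamma>) + flat_peaks ?z)"
    using motzkin_not_starts_flat_D[OF is_motzkin_elevate_append[OF m(3,2)]]
    by (simp add: flat_peaks_append starts_flat_D_Cons)
  moreover have "set (phi \<beta>) \<subseteq> {F} \<longleftrightarrow> ?low"
    using phi_flat_iff[OF 3(2)] dyck_hge_all_height_le_1_iff[OF hge(2)] by simp
  ultimately have "flat_peaks (phi \<alpha> @ phi \<gamma> @ ?z)
      = flat_peaks (phi \<alpha>) + (flat_peaks (phi \<beta>) + flat_peaks (phi \<gamma>) + of_bool ?low)"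
    by simp
  then show ?case
    unfolding lhs phi.simps(3)[OF 3(1-3)] using 3 hge by simp
next
  case (4 P)
  then show ?case using dyck_hge_all_is_dyck by blast
qed

theorem theorem3:
  fixes n :: nat and P :: "step list"
  assumes "P \<in> dyck_hge n"
  shows "occ [U, U, D] P = occ_plus [U] F [D] (phi P) + occ [U, D] (phi P)"
  using occ_UUD_eq_flat_peaks_phi[of P] assms by (simp add: dyck_hge_def flat_peaks_def)

end
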